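(* For every $d \in \mathbb{N}$ (with $d \ge 1$) there exists a non-degenerate $d \times d$-bimatrix game $(A,B)$ of rank $1$ that has at least $2d-1$ Nash equilibria.
   Context: An $m \times n$-bimatrix game is a pair $(A,B)$ of payoff matrices $A,B \in \mathbb{Z}^{m \times n}$. The sets of mixed strategies are $\mathcal{S}_1 = \{x \in \mathbb{R}^m : \sum_i x_i = 1,\ x \ge 0\}$ (player 1) and $\mathcal{S}_2 = \{y \in \mathbb{R}^n : \sum_j y_j = 1,\ y \ge 0\}$ (player 2). Player 1 receives $x^T A y$ and player 2 receives $x^T B y$. A pair $(\overline{x},\overline{y}) \in \mathcal{S}_1 \times \mathcal{S}_2$ is a Nash equilibrium if $\overline{x}^T A \overline{y} \ge x^T A \overline{y}$ and $\overline{x}^T B \overline{y} \ge \overline{x}^T B y$ for all $x \in \mathcal{S}_1$, $y \in \mathcal{S}_2$. The game is a game of rank $k$ (a rank $k$-game) if the matrix $A+B$ has rank at most $k$. For a mixed strategy $y$ of player 2, a pure best response of player 1 is an index $i$ with $(Ay)_i = \max_{i'} (Ay)_{i'}$; for a mixed strategy $x$ of player 1, a pure best response of player 2 is an index $j$ with $(x^TB)_j = \max_{j'} (x^TB)_{j'}$. The game is non-degenerate if for every mixed strategy $y$ of player 2 the number of pure best responses of player 1 to $y$ does not exceed $|\{j : y_j \ne 0\}|$, and for every mixed strategy $x$ of player 1 the number of pure best responses of player 2 to $x$ does not exceed $|\{i : x_i \neq 0\}|$. *)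

theory Defs
  imports "Jordan_Normal_Form.DL_Rank"
begin

abbreviation real_mat :: "int mat \<Rightarrow> real mat" where
  "real_mat \<equiv> map_mat real_of_int"

definition bimatrix_game :: "nat \<Rightarrow> nat \<Rightarrow> int mat \<Rightarrow> int mat \<Rightarrow> bool" where
  "bimatrix_game m n A B \<longleftrightarrow> A \<in> carrier_mat m n \<and> B \<in> carrier_mat m n"

definition mixed_strategies :: "nat \<Rightarrow> real vec set" where
  "mixed_strategies n = {x \<in> carrier_vec n. (\<Sum>i<n. x $ i) = 1 \<and> (\<forall>i<n. 0 \<le> x $ i)}"

definition payoff :: "int mat \<Rightarrow> real vec \<Rightarrow> real vec \<Rightarrow> real" where
  "payoff M x y = x \<bullet> (real_mat M *\<^sub>v y)"

definition nash_equilibrium :: "int mat \<Rightarrow> int mat \<Rightarrow> real vec \<Rightarrow> real vec \<Rightarrow> bool" where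
  "nash_equilibrium A B x y \<longleftrightarrow>
     x \<in> mixed_strategies (dim_row A) \<and> y \<in> mixed_strategies (dim_col A) \<and>
     (\<forall>x' \<in> mixed_strategies (dim_row A). \<forall>y' \<in> mixed_strategies (dim_col A).
        payoff A x y \<ge> payoff A x' y \<and> payoff B x y \<ge> payoff B x y')"

text \<open>Having rank \<open>k\<close> means that the matrix rank of \<open>A + B\<close> is at most \<open>k\<close>, not exactly \<open>k\<close>.\<close>

definition rank_game :: "nat \<Rightarrow> int mat \<Rightarrow> int mat \<Rightarrow> bool" where
  "rank_game k A B \<longleftrightarrow> vec_space.rank (dim_row A) (real_mat (A + B)) \<le> k"

definition best_responses1 :: "int mat \<Rightarrow> real vec \<Rightarrow> nat set" where
  "best_responses1 A y = {i. i < dim_row A \<and>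
     (real_mat A *\<^sub>v y) $ i = Max ((\<lambda>i'. (real_mat A *\<^sub>v y) $ i') ` {..<dim_row A})}"

text \<open>The row vector \<open>x\<^sup>T B\<close> is written as the column vector \<open>B\<^sup>T x\<close>.\<close>

definition best_responses2 :: "int mat \<Rightarrow> real vec \<Rightarrow> nat set" where
  "best_responses2 B x = {j. j < dim_col B \<and>
     (transpose_mat (real_mat B) *\<^sub>v x) $ j =
       Max ((\<lambda>j'. (transpose_mat (real_mat B) *\<^sub>v x) $ j') ` {..<dim_col B})}"

definition nondegenerate :: "int mat \<Rightarrow> int mat \<Rightarrow> bool" where
  "nondegenerate A B \<longleftrightarrow>
     (\<forall>y \<in> mixed_strategies (dim_col A).
        card (best_responses1 A y) \<le> card {j. j < dim_col A \<and> y $ j \<noteq> 0}) \<and>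
     (\<forall>x \<in> mixed_strategies (dim_row B).
        card (best_responses2 B x) \<le> card {i. i < dim_row B \<and> x $ i \<noteq> 0})"

end

(* With payoffs a_ij = 2ij - i^2 + j^2 and B the transpose of A, the matrix A + B = (4ij) has rank
   at most 1. Against a mixed strategy y with mean m = sum_j j y_j, row i earns a constant minus
   (i - m)^2, so the best responses are the indices nearest to m. There are at most two of them, and
   two only if m is a half-integer, which forces y to mix; hence non-degeneracy. Every unit vector
   and every uniform mixture of two adjacent unit vectors is a best response to itself, which gives
   d + (d - 1) symmetric equilibria. *)

theory Submission
  imports Defs
begin

text \<open>The entry equals 2 j^2 - (i - j)^2, a parabola in the row index that peaks at the column
  index. The summand j^2 shifts each column by a constant and makes the squares cancel when the
  transpose is added.\<close>

definition parabola_game :: "nat \<Rightarrow> int mat" where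
  "parabola_game d = mat d d (\<lambda>(i, j). 2 * int i * int j - (int i)\<^sup>2 + (int j)\<^sup>2)"

definition mean :: "nat \<Rightarrow> real vec \<Rightarrow> real" where
  "mean d x = (\<Sum>j<d. real j * x $ j)"

lemma dim_parabola_game [simp]:
  "dim_row (parabola_game d) = d" "dim_col (parabola_game d) = d"
  by (simp_all add: parabola_game_def)

lemma parabola_game_mult_vec:
  assumes y: "y \<in> mixed_strategies d"
  obtains c where "\<And>i. i < d \<Longrightarrow>
    (real_mat (parabola_game d) *\<^sub>v y) $ i = c - (real i - mean d y)\<^sup>2"
proof
  fix i assume i: "i < d"
  have dim: "dim_vec y = d" and one: "(\<Sum>j<d. y $ j) = 1"
    using y by (auto simp: mixed_strategies_def)
  have "(real_mat (parabola_game d) *\<^sub>v y) $ i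
      = (\<Sum>j<d. (2 * real i * real j - (real i)\<^sup>2 + (real j)\<^sup>2) * y $ j)"
    using i dim
    by (auto simp: parabola_game_def scalar_prod_def lessThan_atLeast0 intro!: sum.cong)
  also have "\<dots> = (\<Sum>j<d. 2 * real i * (real j * y $ j) - (real i)\<^sup>2 * y $ j + (real j)\<^sup>2 * y $ j)"
    by (simp add: algebra_simps)
  also have "\<dots> = 2 * real i * mean d y - (real i)\<^sup>2 + (\<Sum>j<d. (real j)\<^sup>2 * y $ j)"
    by (simp only: sum.distrib sum_subtractf sum_distrib_left [symmetric] one mean_def)
  \<comment> \<open>Completing the square in \<open>real i\<close>. The parenthesised term does not
    depend on \<open>i\<close> and serves as the promised \<open>c\<close>.\<close>
  finally show "(real_mat (parabola_game d) *\<^sub>v y) $ i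
      = ((\<Sum>j<d. (real j)\<^sup>2 * y $ j) + (mean d y)\<^sup>2) - (real i - mean d y)\<^sup>2"
    by (simp add: power2_eq_square algebra_simps)
qed

lemma best_responses1_parabola_game:
  assumes y: "y \<in> mixed_strategies d"
  shows "best_responses1 (parabola_game d) y
    = {i. i < d \<and> (\<forall>k<d. (real i - mean d y)\<^sup>2 \<le> (real k - mean d y)\<^sup>2)}"
proof -
  obtain c where c: "\<And>i. i < d \<Longrightarrow>
      (real_mat (parabola_game d) *\<^sub>v y) $ i = c - (real i - mean d y)\<^sup>2"
    using parabola_game_mult_vec [OF y] by blast
  define f where "f i = (real_mat (parabola_game d) *\<^sub>v y) $ i" for i
  have "f i = Max (f ` {..<d}) \<longleftrightarrow> (\<forall>k<d. f k \<le> f i)" if "i < d" for i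
    using that by (subst eq_commute, subst Max_eq_iff) auto
  moreover have "f k \<le> f i \<longleftrightarrow> (real i - mean d y)\<^sup>2 \<le> (real k - mean d y)\<^sup>2"
    if "i < d" "k < d" for i k
    using that by (simp add: f_def c del: index_mult_mat_vec)
  ultimately show ?thesis
    unfolding best_responses1_def by (auto simp flip: f_def)
qed

text \<open>Transposing twice gives back \<open>A\<close>, so for the game with \<open>B\<close> the
  transpose of \<open>A\<close> player 2's half of non-degeneracy reduces to player 1's.\<close>

lemma best_responses2_transpose:
  "best_responses2 (transpose_mat A) x = best_responses1 A x"
  by (simp add: best_responses1_def best_responses2_def map_mat_transpose)

text \<open>All the weight, which is 1, sits on the single index \<open>k\<close>. Hence a
  half-integral mean is impossible for a pure strategy.\<close>

lemma mean_eq_of_support: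
  assumes y: "y \<in> mixed_strategies d" and supp: "{j. j < d \<and> y $ j \<noteq> 0} = {k}"
  shows "mean d y = real k"
proof -
  have k: "k < d" and zero: "\<And>j. j < d \<Longrightarrow> j \<noteq> k \<Longrightarrow> y $ j = 0"
    using supp by auto
  have "(\<Sum>j<d. y $ j) = (\<Sum>j\<in>{k}. y $ j)" "mean d y = (\<Sum>j\<in>{k}. real j * y $ j)"
    unfolding mean_def using k zero by (rule_tac sum.mono_neutral_right; auto)+
  then show ?thesis
    using y by (auto simp: mixed_strategies_def)
qed

text \<open>A pure strategy has an integer mean and so a unique nearest index. Any other strategy
  has at least two indices in its support, while no point has more than two nearest indices.\<close>

lemma card_best_responses1_parabola_game:
  assumes y: "y \<in> mixed_strategies d"
  shows "card (best_responses1 (parabola_game d) y) \<le> card {j. j < d \<and> y $ j \<noteq> 0}"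
    (is "card ?R \<le> card ?S")
proof -
  note R = best_responses1_parabola_game [OF y]
  have fin: "finite ?R" "finite ?S"
    by (auto simp: R)
  have "?S \<noteq> {}"
  proof
    assume "?S = {}"
    then have "(\<Sum>j<d. y $ j) = 0"
      by (intro sum.neutral) auto
    then show False
      using y by (auto simp: mixed_strategies_def)
  qed
  then have pos: "card ?S \<ge> 1"
    using fin by (simp add: Suc_le_eq card_gt_0_iff)
  show ?thesis
  proof (cases "card ?S = 1")
    case True
    then obtain k where k: "?S = {k}"
      by (rule card_1_singletonE)
    have m: "mean d y = real k"
      by (rule mean_eq_of_support [OF y k])
    have "k < d" using k by auto
    \<comment> \<open>The index \<open>k\<close> itself has distance 0 from the mean, and no other
      index does.\<close>
    then have "?R \<subseteq> {k}"
      by (force simp: R m)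
    then have "card ?R \<le> card {k}"
      by (rule card_mono [rotated]) simp
    then show ?thesis
      using True by simp
  next
    case False
    \<comment> \<open>Two nearest indices are equidistant from the mean, so if distinct they are
      mirror images in it. A third one would have to coincide with one of them.\<close>
    have sym: "real i + real k = 2 * mean d y" if "i \<in> ?R" "k \<in> ?R" "i \<noteq> k" for i k
    proof -
      have "(real i - mean d y)\<^sup>2 = (real k - mean d y)\<^sup>2"
        using that by (auto simp: R intro: antisym)
      then show ?thesis
        using that by (auto simp: power2_eq_iff)
    qed
    have "card ?R \<le> 2"
    proof (rule ccontr)
      assume "\<not> card ?R \<le> 2"
      then obtain T where T: "T \<subseteq> ?R" "card T = 3"
        using obtain_subset_with_card_n [of 3 ?R] by auto
      then obtain a b c where "T = {a, b, c}" "a \<noteq> b" "b \<noteq> c" "a \<noteq> c"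
        by (metis card_3_iff)
      then show False
        using T sym [of a b] sym [of a c] by auto
    qed
    then show ?thesis
      using pos False by linarith
  qed
qed

lemma nondegenerate_parabola_game:
  "nondegenerate (parabola_game d) (transpose_mat (parabola_game d))"
  by (simp add: nondegenerate_def best_responses2_transpose card_best_responses1_parabola_game)

lemma rank_game_parabola_game:
  "rank_game 1 (parabola_game d) (transpose_mat (parabola_game d))"
  unfolding rank_game_def
  \<comment> \<open>The squares cancel in the sum with the transpose, leaving 4 i j as an outer
    product.\<close>
  by (rule vec_space.rank_le_1_product_entries
      [where f = "\<lambda>i. 4 * real i" and g = real and nc = d])
    (auto simp: parabola_game_def)

lemma payoff_transpose:
  assumes "x \<in> carrier_vec (dim_col A)" "y \<in> carrier_vec (dim_row A)"
  shows "payoff (transpose_mat A) x y = payoff A y x"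
proof -
  have A: "real_mat A \<in> carrier_mat (dim_row A) (dim_col A)"
    by auto
  have "payoff (transpose_mat A) x y = ((real_mat A)\<^sup>T *\<^sub>v y) \<bullet> x"
    unfolding payoff_def map_mat_transpose
    using assms by (intro comm_scalar_prod [of _ "dim_col A"]) (auto intro!: mult_mat_vec_carrier)
  also have "\<dots> = payoff A y x"
    unfolding payoff_def using transpose_vec_mult_scalar [OF A assms] by simp
  finally show ?thesis .
qed

text \<open>When both players use \<open>x\<close>, transposition turns player 2's deviations into
  player 1's, so one inequality covers both.\<close>

lemma nash_equilibrium_symmetric:
  assumes A: "A \<in> carrier_mat d d" and x: "x \<in> mixed_strategies d"
    and best: "\<And>z. z \<in> mixed_strategies d \<Longrightarrow> payoff A z x \<le> payoff A x x"
  shows "nash_equilibrium A (transpose_mat A) x x"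
proof -
  have "payoff (transpose_mat A) x z = payoff A z x" if "z \<in> mixed_strategies d" for z
    using A x that by (intro payoff_transpose) (auto simp: mixed_strategies_def)
  then show ?thesis
    using assms by (auto simp: nash_equilibrium_def)
qed

text \<open>One index \<open>k\<close> enumerates both kinds of equilibria: for even
  \<open>k\<close> the two halves coincide and give a unit vector, for odd \<open>k\<close> they
  fall on adjacent indices.\<close>

definition adjacent_mix :: "nat \<Rightarrow> nat \<Rightarrow> real vec" where
  "adjacent_mix d k = vec d (\<lambda>i. of_bool (i = k div 2) / 2 + of_bool (i = Suc k div 2) / 2)"

lemma sum_adjacent_mix:
  assumes "Suc k div 2 < d"
  shows "(\<Sum>i<d. f i * adjacent_mix d k $ i) = (f (k div 2) + f (Suc k div 2)) / 2"
proof -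
  have "k div 2 < d"
    using assms by linarith
  have "(\<Sum>i<d. f i * adjacent_mix d k $ i)
      = (\<Sum>i<d. (if i = k div 2 then f i / 2 else 0) + (if i = Suc k div 2 then f i / 2 else 0))"
    by (rule sum.cong) (auto simp: adjacent_mix_def field_simps)
  also have "\<dots> = (f (k div 2) + f (Suc k div 2)) / 2"
    using assms \<open>k div 2 < d\<close> by (simp add: sum.distrib add_divide_distrib)
  finally show ?thesis .
qed

lemma adjacent_mix_in_mixed_strategies:
  assumes "Suc k div 2 < d"
  shows "adjacent_mix d k \<in> mixed_strategies d"
  using sum_adjacent_mix [OF assms, of "\<lambda>_. 1"]
  by (auto simp: mixed_strategies_def adjacent_mix_def)

text \<open>The two indices are k/2 rounded down and up, so they add up to \<open>k\<close>. The
  value locates the best responses and also tells the strategies apart.\<close>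

lemma mean_adjacent_mix:
  assumes "Suc k div 2 < d"
  shows "mean d (adjacent_mix d k) = real k / 2"
proof -
  have "k div 2 + Suc k div 2 = k"
    by presburger
  then show ?thesis
    using sum_adjacent_mix [OF assms, of real] by (simp add: mean_def flip: of_nat_add)
qed

text \<open>A common bound \<open>v\<close> on all row payoffs is attained on the support of the
  mixture, so no strategy earns more than \<open>v\<close> and the mixture earns exactly
  \<open>v\<close>.\<close>

lemma nash_equilibrium_adjacent_mix:
  assumes k: "Suc k div 2 < d"
  shows "nash_equilibrium (parabola_game d) (transpose_mat (parabola_game d))
    (adjacent_mix d k) (adjacent_mix d k)"
proof (rule nash_equilibrium_symmetric)
  let ?x = "adjacent_mix d k" and ?A = "parabola_game d"
  have x: "?x \<in> mixed_strategies d"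
    by (rule adjacent_mix_in_mixed_strategies [OF k])
  show "?A \<in> carrier_mat d d"
    by (simp add: parabola_game_def)
  show "?x \<in> mixed_strategies d"
    by (rule x)
  fix z assume z: "z \<in> mixed_strategies d"
  obtain c where c: "\<And>i. i < d \<Longrightarrow> (real_mat ?A *\<^sub>v ?x) $ i = c - (real i - real k / 2)\<^sup>2"
    using parabola_game_mult_vec [OF x] mean_adjacent_mix [OF k] by metis
  have payoff: "payoff ?A w ?x = (\<Sum>i<d. (c - (real i - real k / 2)\<^sup>2) * w $ i)" for w
    by (auto simp: payoff_def scalar_prod_def c lessThan_atLeast0 mult.commute
        simp del: index_mult_mat_vec intro!: sum.cong)
  (* Twice the distance of an integer to k/2 is an integer of the parity of k. *)
  define v where "v = c - real (k mod 2) / 4"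
  have upper: "c - (real i - real k / 2)\<^sup>2 \<le> v" for i
  proof -
    have "int (k mod 2) \<le> (2 * int i - int k)\<^sup>2"
    proof (cases "even k")
      case False
      then have "2 * int i - int k \<noteq> 0"
        by presburger
      then have "1 \<le> (2 * int i - int k)\<^sup>2"
        by (simp add: int_one_le_iff_zero_less)
      then show ?thesis
        by (metis False odd_iff_mod_2_eq_one of_nat_1)
    qed simp
    then have "real_of_int (int (k mod 2)) \<le> real_of_int ((2 * int i - int k)\<^sup>2)"
      by (rule of_int_le_iff [THEN iffD2])
    then show ?thesis
      by (simp add: v_def power2_eq_square field_simps)
  qed
  have "(\<Sum>i<d. (c - (real i - real k / 2)\<^sup>2) * z $ i) \<le> (\<Sum>i<d. v * z $ i)"
    using z upper by (intro sum_mono mult_right_mono) (auto simp: mixed_strategies_def)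
  also have "\<dots> = v"
    using z by (simp add: mixed_strategies_def flip: sum_distrib_left)
  \<comment> \<open>Both indices in the mixture lie at distance 0 from k/2 if \<open>k\<close> is
    even and 1/2 if \<open>k\<close> is odd, which is where the bound is tight.\<close>
  also have "v = (\<Sum>i<d. (c - (real i - real k / 2)\<^sup>2) * ?x $ i)"
    unfolding sum_adjacent_mix [OF k] v_def
  proof (cases "even k")
    case True
    then show "c - real (k mod 2) / 4 = (c - (real (k div 2) - real k / 2)\<^sup>2 +
        (c - (real (Suc k div 2) - real k / 2)\<^sup>2)) / 2"
      by (elim evenE) simp
  next
    case False
    then obtain l where "k = 2 * l + 1"
      by (elim oddE)
    moreover from this have "k mod 2 = 1" "k div 2 = l" "Suc k div 2 = l + 1"
      by simp_all
    ultimately show "c - real (k mod 2) / 4 = (c - (real (k div 2) - real k / 2)\<^sup>2 +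
        (c - (real (Suc k div 2) - real k / 2)\<^sup>2)) / 2"
      by (simp add: power2_eq_square field_simps)
  qed
  finally show "payoff ?A z ?x \<le> payoff ?A ?x ?x"
    by (simp add: payoff)
qed

theorem theorem3p3:
  fixes d :: nat
  assumes "d \<ge> 1"
  shows "\<exists>A B. bimatrix_game d d A B \<and> nondegenerate A B \<and> rank_game 1 A B \<and>
           (\<exists>E. E \<subseteq> {(x, y). nash_equilibrium A B x y} \<and> finite E \<and> card E \<ge> 2 * d - 1)"
proof (intro exI conjI)
  let ?E = "(\<lambda>k. (adjacent_mix d k, adjacent_mix d k)) ` {..<2 * d - 1}"
  \<comment> \<open>The largest \<open>k\<close> is 2d - 2, for which the mixture is the unit vector
    at the last index d - 1.\<close>
  have lt: "Suc k div 2 < d" if "k < 2 * d - 1" for k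
    using that by linarith
  show "bimatrix_game d d (parabola_game d) (transpose_mat (parabola_game d))"
    by (simp add: bimatrix_game_def parabola_game_def)
  show "nondegenerate (parabola_game d) (transpose_mat (parabola_game d))"
    by (rule nondegenerate_parabola_game)
  show "rank_game 1 (parabola_game d) (transpose_mat (parabola_game d))"
    by (rule rank_game_parabola_game)
  show "?E \<subseteq> {(x, y). nash_equilibrium (parabola_game d) (transpose_mat (parabola_game d)) x y}"
    using nash_equilibrium_adjacent_mix lt by auto
  show "finite ?E"
    by simp
  \<comment> \<open>The mean k/2 recovers \<open>k\<close> from the strategy.\<close>
  have "inj_on (\<lambda>k. (adjacent_mix d k, adjacent_mix d k)) {..<2 * d - 1}"
  proof (rule inj_onI)
    fix k l
    assume kl: "k \<in> {..<2 * d - 1}" "l \<in> {..<2 * d - 1}"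
      and "(adjacent_mix d k, adjacent_mix d k) = (adjacent_mix d l, adjacent_mix d l)"
    then have "mean d (adjacent_mix d k) = mean d (adjacent_mix d l)"
      by simp
    then show "k = l"
      using kl by (simp add: mean_adjacent_mix lt)
  qed
  then show "2 * d - 1 \<le> card ?E"
    by (simp add: card_image)
qed

end
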